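(* Let $k$ be any integral domain of any characteristic. Let $H(z)\in k\langle\langle z\rangle\rangle^{\times n}$ with $o(H(z))\ge2$, let $F_t(z)=z-tH(z)$, write the inverse map of $F_t(z)$ as $G_t(z)=z+tN_t(z)$ with $N_t(z)\in k[[t]]\langle\langle z\rangle\rangle^{\times n}$, and write $N_t(z)=\sum_{m\ge1}t^{m-1}N_{[m]}(z)$ with $N_{[m]}(z)\in k\langle\langle z\rangle\rangle^{\times n}$. Then: (a) If $\operatorname{char} k=0$, the sequence $\{N_{[m]}(z)\mid m\ge1\}$ is completely determined by $$N_{[1]}(z)=H(z),\qquad N_{[m]}(z)=\frac1{m-1}\sum_{\substack{i+l=m\\ i,l\ge1}}\left[N_{[i]}\frac{\partial}{\partial z}\right]N_{[l]}(z)\quad\text{for any } m\ge2.$$ (b) If $\operatorname{char} k=p>0$, the recurrent relations above still hold for any $m\ge2$ with $m\not\equiv1\pmod p$. When $m=qp+1$ for some $q\ge1$, $N_{[m]}(z)$ is obtained by $$N_{[m]}(z)=-\operatorname{Res}_t\sum_{l=1}^{m-1}t^{\,l-m-1}N_{[l]}(z-tH(z)).$$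
   Context: $n\ge 1$; $z=(z_1,\dots,z_n)$ are noncommutative free variables; $t$ is a formal parameter commuting with $z$. Integral domains are commutative and unital. $k\langle\langle z\rangle\rangle$ and $k[[t]]\langle\langle z\rangle\rangle$ are the algebras of formal power series in the noncommuting variables $z_i$ over $k$ and $k[[t]]$. The order $o(U)$ of a vector $U$ is the minimum of the orders (lowest degree in $z$) of its components. The inverse map $G_t$ of $F_t$ is the vector with $F_t(G_t(z))=z=G_t(F_t(z))$, where $u(F_t)$ denotes substitution of the components of $F_t$ for the $z_i$ (componentwise for vectors); it exists and is of the form $z+tN_t(z)$ with $o(N_t(z))\ge2$. For a vector $\vec u=(u_1,\dots,u_n)$ over $k\langle\langle z\rangle\rangle$, $[\vec u\frac{\partial}{\partial z}]$ denotes the unique $k$-derivation of $k\langle\langle z\rangle\rangle$ sending $z_i$ to $u_i$ for all $i$; applied to a vector it acts componentwise. $\operatorname{Res}_t$ denotes the coefficient of $t^{-1}$ of a Laurent series in $t$; thus $\operatorname{Res}_t\,t^{l-m-1}N_{[l]}(z-tH)$ is the coefficient of $t^{m-l}$ in $N_{[l]}(z-tH)$. In (a), division by the integer $m-1$ is read over the fraction field of $k$. *)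

theory Defs
  imports
    "HOL-Analysis.Finite_Cartesian_Product"
    "HOL-Library.Extended_Nat"
    "HOL-Computational_Algebra.Computational_Algebra"
    "HOL-Number_Theory.Cong"
begin

unbundle no fps_syntax

section \<open>Formal power series in noncommuting variables\<close>

text \<open>
  A formal power series over \<open>'a\<close> in noncommuting variables indexed by \<open>'n\<close> is a coefficient
  function on words in the variables. Multiplication by scalars is multiplication by the
  (central) constant series \<open>nc_const c\<close>.
\<close>

typedef ('a, 'n) ncps = "UNIV :: ('n list \<Rightarrow> 'a) set"
  morphisms nc_coeff Abs_ncps ..

lemma nc_coeff_Abs [simp]: "nc_coeff (Abs_ncps f) = f"
  by (simp add: Abs_ncps_inverse)

lemma ncps_eqI: "(\<And>w. nc_coeff f w = nc_coeff g w) \<Longrightarrow> f = g"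
  by (metis ext nc_coeff_inject)

definition nc_const :: "'a::zero \<Rightarrow> ('a, 'n) ncps" where
  "nc_const c = Abs_ncps (\<lambda>w. if w = [] then c else 0)"

definition nc_var :: "'n \<Rightarrow> ('a::zero_neq_one, 'n) ncps" where
  "nc_var i = Abs_ncps (\<lambda>w. if w = [i] then 1 else 0)"

definition nc_map :: "('a \<Rightarrow> 'b) \<Rightarrow> ('a, 'n) ncps \<Rightarrow> ('b, 'n) ncps" where
  "nc_map \<phi> f = Abs_ncps (\<lambda>w. \<phi> (nc_coeff f w))"

text \<open>The \<open>nc_shift i f\<close> are the series in
  \<open>f = nc_const (nc_coeff f []) + (\<Sum>i\<in>UNIV. nc_var i * nc_shift i f)\<close>.\<close>

definition nc_shift :: "'n \<Rightarrow> ('a, 'n) ncps \<Rightarrow> ('a, 'n) ncps" where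
  "nc_shift i f = Abs_ncps (\<lambda>w. nc_coeff f (i # w))"

lemma nc_coeff_shift [simp]: "nc_coeff (nc_shift i f) w = nc_coeff f (i # w)"
  by (simp add: nc_shift_def)

lemma nc_coeff_map [simp]: "nc_coeff (nc_map \<phi> f) w = \<phi> (nc_coeff f w)"
  by (simp add: nc_map_def)

lemma nc_coeff_const: "nc_coeff (nc_const c) w = (if w = [] then c else 0)"
  by (simp add: nc_const_def)

lemma nc_coeff_var: "nc_coeff (nc_var i) w = (if w = [i] then 1 else 0)"
  by (simp add: nc_var_def)

instantiation ncps :: (comm_ring_1, type) "{zero, one, plus, minus, uminus, times}"
begin

definition "0 = nc_const 0"
definition "1 = nc_const 1"
definition "f + g = Abs_ncps (\<lambda>w. nc_coeff f w + nc_coeff g w)"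
definition "f - g = Abs_ncps (\<lambda>w. nc_coeff f w - nc_coeff g w)"
definition "- f = Abs_ncps (\<lambda>w. - nc_coeff f w)"
definition "f * g =
  Abs_ncps (\<lambda>w. \<Sum>i\<le>length w. nc_coeff f (take i w) * nc_coeff g (drop i w))"

instance ..

end

lemma nc_coeff_simps [simp]:
  fixes f g :: "('a::comm_ring_1, 'n) ncps"
  shows "nc_coeff (0 :: ('a, 'n) ncps) w = 0"
    and "nc_coeff (1 :: ('a, 'n) ncps) w = (if w = [] then 1 else 0)"
    and "nc_coeff (f + g) w = nc_coeff f w + nc_coeff g w"
    and "nc_coeff (f - g) w = nc_coeff f w - nc_coeff g w"
    and "nc_coeff (- f) w = - nc_coeff f w"
  by (simp_all add: zero_ncps_def one_ncps_def plus_ncps_def minus_ncps_def uminus_ncps_def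
      nc_coeff_const)

lemma nc_coeff_mult:
  "nc_coeff (f * g) w = (\<Sum>i\<le>length w. nc_coeff f (take i w) * nc_coeff g (drop i w))"
  by (simp add: times_ncps_def)

lemma nc_coeff_mult_Nil [simp]: "nc_coeff (f * g) [] = nc_coeff f [] * nc_coeff g []"
  by (simp add: nc_coeff_mult)

lemma nc_coeff_mult_Cons:
  "nc_coeff (f * g) (x # w) = nc_coeff f [] * nc_coeff g (x # w) + nc_coeff (nc_shift x f * g) w"
  by (simp add: nc_coeff_mult sum.atMost_Suc_shift del: sum.atMost_Suc)

lemma nc_coeff_const_mult [simp]: "nc_coeff (nc_const c * f) w = c * nc_coeff f w"
proof (cases w)
  case (Cons x v)
  have "nc_coeff (nc_shift x (nc_const c) * f) v = 0"
    by (simp add: nc_coeff_mult nc_coeff_const)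
  with Cons show ?thesis
    by (simp add: nc_coeff_mult_Cons nc_coeff_const)
qed (simp add: nc_coeff_const)

lemma nc_shift_mult: "nc_shift x (f * g) = nc_const (nc_coeff f []) * nc_shift x g + nc_shift x f * g"
  by (rule ncps_eqI) (simp add: nc_coeff_mult_Cons)

lemma nc_coeff_add_mult:
  "nc_coeff ((f + g) * h) w = nc_coeff (f * h) w + nc_coeff (g * h) w"
  by (simp add: nc_coeff_mult sum.distrib distrib_right)

lemma nc_coeff_const_mult_mult:
  "nc_coeff (nc_const c * f * g) w = c * nc_coeff (f * g) w"
  by (simp add: nc_coeff_mult[of "nc_const c * f" g] nc_coeff_mult[of f g] sum_distrib_left
      mult.assoc)

instance ncps :: (comm_ring_1, type) ring_1
proof
  fix f g h :: "('a, 'n) ncps"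
  show "f * g * h = f * (g * h)"
  proof (rule ncps_eqI)
    fix w
    show "nc_coeff (f * g * h) w = nc_coeff (f * (g * h)) w"
    proof (induction w arbitrary: f)
      case (Cons x w)
      have "nc_coeff (nc_shift x (f * g) * h) w
        = nc_coeff f [] * nc_coeff (nc_shift x g * h) w + nc_coeff (nc_shift x f * g * h) w"
        by (simp add: nc_shift_mult nc_coeff_add_mult nc_coeff_const_mult_mult)
      with Cons.IH show ?case
        by (simp add: nc_coeff_mult_Cons algebra_simps)
    qed (simp add: mult.assoc)
  qed
  show "1 * f = f"
    by (rule ncps_eqI) (simp add: one_ncps_def)
  show "f * 1 = f"
  proof (rule ncps_eqI)
    fix w
    show "nc_coeff (f * 1) w = nc_coeff f w"
      by (induction w arbitrary: f) (simp_all add: nc_coeff_mult_Cons)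
  qed
  show "(0 :: ('a, 'n) ncps) \<noteq> 1"
  proof
    assume "(0 :: ('a, 'n) ncps) = 1"
    then have "nc_coeff (0 :: ('a, 'n) ncps) [] = nc_coeff (1 :: ('a, 'n) ncps) []"
      by simp
    then show False
      by simp
  qed
qed (rule ncps_eqI; simp add: nc_coeff_mult algebra_simps sum.distrib)+

lemma nc_coeff_sum [simp]: "nc_coeff (sum F A) w = (\<Sum>a\<in>A. nc_coeff (F a) w)"
  by (induction A rule: infinite_finite_induct) simp_all

text \<open>The order of \<open>0\<close> is \<open>\<infinity>\<close>.\<close>

definition nc_order :: "('a::zero, 'n) ncps \<Rightarrow> enat" where
  "nc_order f = (INF w\<in>{w. nc_coeff f w \<noteq> 0}. enat (length w))"

text \<open>
  Substitution of the components of \<open>U\<close> for the variables in \<open>f\<close>. The definition is meant for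
  \<open>U\<close> of order at least 1: then a word \<open>v\<close> longer than \<open>w\<close> contributes nothing to the
  coefficient of \<open>w\<close>, which makes the sum finite.
\<close>

definition nc_subst :: "('a::comm_ring_1, 'n::finite) ncps \<Rightarrow> ('a, 'n) ncps ^ 'n \<Rightarrow> ('a, 'n) ncps"
  where "nc_subst f U = Abs_ncps (\<lambda>w. \<Sum>v\<in>{v. length v \<le> length w}.
    nc_coeff f v * nc_coeff (prod_list (map (\<lambda>i. U $ i) v)) w)"


section \<open>Derivations\<close>

definition nc_derivation :: "(('a::comm_ring_1, 'n) ncps \<Rightarrow> ('a, 'n) ncps) \<Rightarrow> bool" where
  "nc_derivation D \<longleftrightarrow>
    (\<forall>f g. D (f + g) = D f + D g) \<and>
    (\<forall>c f. D (nc_const c * f) = nc_const c * D f) \<and>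
    (\<forall>f g. D (f * g) = D f * g + f * D g)"

text \<open>The derivation \<open>[u \<partial>/\<partial>z]\<close>; see \<open>nc_deriv_ex1\<close> below for existence and uniqueness.\<close>

definition nc_deriv ::
  "('a::comm_ring_1, 'n::finite) ncps ^ 'n \<Rightarrow> ('a, 'n) ncps \<Rightarrow> ('a, 'n) ncps" where
  "nc_deriv u = (THE D. nc_derivation D \<and> (\<forall>i. D (nc_var i) = u $ i))"

lemma nc_shift_simps [simp]:
  fixes f g :: "('a::comm_ring_1, 'n) ncps"
  shows "nc_shift i (f + g) = nc_shift i f + nc_shift i g"
    and "nc_shift i (nc_const c * f) = nc_const c * nc_shift i f"
    and "nc_shift i (nc_const c :: ('a, 'n) ncps) = 0"
    and "nc_shift i (nc_var j :: ('a, 'n) ncps) = (if i = j then 1 else 0)"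
  by (rule ncps_eqI; simp add: nc_coeff_const nc_coeff_var)+

lemma nc_const_commute: "nc_const c * f = f * nc_const c"
proof (rule ncps_eqI)
  fix w
  have "nc_coeff (f * nc_const c) w = c * nc_coeff f w"
    by (induction w arbitrary: f) (simp_all add: nc_coeff_mult_Cons nc_coeff_const)
  then show "nc_coeff (nc_const c * f) w = nc_coeff (f * nc_const c) w"
    by simp
qed

lemma nc_coeff_var_mult_Nil [simp]: "nc_coeff (nc_var i * f) [] = 0"
  by (simp add: nc_coeff_var)

lemma nc_coeff_var_mult_Cons [simp]:
  "nc_coeff (nc_var i * f) (x # w) = (if i = x then nc_coeff f w else 0)"
proof -
  have "nc_coeff ((0 :: ('a, 'b) ncps) * f) w = 0"
    by simp
  then show ?thesis
    by (simp add: nc_coeff_mult_Cons nc_coeff_var)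
qed

lemma nc_decompose:
  fixes f :: "('a::comm_ring_1, 'n::finite) ncps"
  shows "f = nc_const (nc_coeff f []) + (\<Sum>i\<in>UNIV. nc_var i * nc_shift i f)"
proof (rule ncps_eqI)
  fix w
  show "nc_coeff f w =
      nc_coeff (nc_const (nc_coeff f []) + (\<Sum>i\<in>UNIV. nc_var i * nc_shift i f)) w"
    by (cases w) (simp_all add: nc_coeff_const nc_coeff_var)
qed

lemma nc_derivation_sum:
  assumes "nc_derivation D"
  shows "D (sum F A) = (\<Sum>a\<in>A. D (F a))"
proof -
  have *: "D (f + g) = D f + D g" for f g
    using assms by (simp add: nc_derivation_def)
  from *[of 0 0] have "D 0 = 0"
    by simp
  with * show ?thesis
    by (induction A rule: infinite_finite_induct) simp_all
qed

lemma nc_derivation_unfold: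
  fixes u :: "('a::comm_ring_1, 'n::finite) ncps ^ 'n"
  assumes D: "nc_derivation D" and "\<forall>i. D (nc_var i) = u $ i"
  shows "D f = (\<Sum>i\<in>UNIV. u $ i * nc_shift i f + nc_var i * D (nc_shift i f))"
proof -
  have D_add: "D (g + h) = D g + D h"
    and D_smult: "D (nc_const c * g) = nc_const c * D g"
    and D_mult: "D (g * h) = D g * h + g * D h" for c g h
    using D unfolding nc_derivation_def by blast+
  have "D 1 = 0"
    using D_mult[of 1 1] by simp
  then have D_const: "D (nc_const c) = 0" for c
    using D_smult[of c 1] by simp
  have "D f = D (nc_const (nc_coeff f []) + (\<Sum>i\<in>UNIV. nc_var i * nc_shift i f))"
    using nc_decompose[of f] by simp
  also have "\<dots> = (\<Sum>i\<in>UNIV. D (nc_var i * nc_shift i f))"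
    by (simp add: D_add D_const nc_derivation_sum[OF D])
  finally show ?thesis
    using assms(2) by (simp add: D_mult)
qed

primrec nc_deriv_coeff :: "('a::comm_ring_1, 'n::finite) ncps ^ 'n \<Rightarrow> 'n list \<Rightarrow>
    ('a, 'n) ncps \<Rightarrow> 'a" where
  "nc_deriv_coeff u [] f = nc_coeff (\<Sum>i\<in>UNIV. u $ i * nc_shift i f) []"
| "nc_deriv_coeff u (x # w) f =
    nc_coeff (\<Sum>i\<in>UNIV. u $ i * nc_shift i f) (x # w) + nc_deriv_coeff u w (nc_shift x f)"

lemma nc_deriv_ex1:
  fixes u :: "('a::comm_ring_1, 'n::finite) ncps ^ 'n"
  shows "\<exists>!D. nc_derivation D \<and> (\<forall>i. D (nc_var i) = u $ i)"
proof (rule ex_ex1I)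
  define E where "E f = (\<Sum>i\<in>UNIV. u $ i * nc_shift i f)" for f
  define D where "D f = Abs_ncps (\<lambda>w. nc_deriv_coeff u w f)" for f
  have D_Nil: "nc_coeff (D f) [] = nc_coeff (E f) []" for f
    by (simp add: D_def E_def)
  have D_Cons: "nc_coeff (D f) (x # w) = nc_coeff (E f) (x # w) + nc_coeff (D (nc_shift x f)) w"
    for f x w
    by (simp add: D_def E_def)
  have E_add: "E (f + g) = E f + E g" for f g
    by (simp add: E_def distrib_left sum.distrib)
  have E_smult: "E (nc_const c * f) = nc_const c * E f" for c f
  proof -
    have "u $ i * (nc_const c * nc_shift i f) = nc_const c * (u $ i * nc_shift i f)" for i
      by (metis nc_const_commute mult.assoc)
    then show ?thesis
      by (simp add: E_def sum_distrib_left)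
  qed
  have D_add: "D (f + g) = D f + D g" for f g
  proof (rule ncps_eqI)
    fix w show "nc_coeff (D (f + g)) w = nc_coeff (D f + D g) w"
      by (induction w arbitrary: f g) (simp_all add: D_Nil D_Cons E_add)
  qed
  have D_smult: "D (nc_const c * f) = nc_const c * D f" for c f
  proof (rule ncps_eqI)
    fix w show "nc_coeff (D (nc_const c * f)) w = nc_coeff (nc_const c * D f) w"
      by (induction w arbitrary: f) (simp_all add: D_Nil D_Cons E_smult distrib_left)
  qed
  have D_eq: "D f = E f + (\<Sum>i\<in>UNIV. nc_var i * D (nc_shift i f))" for f
  proof (rule ncps_eqI)
    fix w show "nc_coeff (D f) w = nc_coeff (E f + (\<Sum>i\<in>UNIV. nc_var i * D (nc_shift i f))) w"
      by (cases w) (simp_all add: D_Nil D_Cons nc_coeff_var)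
  qed
  have E_mult: "E (f * g) = nc_const (nc_coeff f []) * E g + E f * g" for f g
  proof -
    have "u $ i * nc_shift i (f * g) =
        nc_const (nc_coeff f []) * (u $ i * nc_shift i g) + u $ i * nc_shift i f * g" for i
      by (simp add: nc_shift_mult distrib_left) (metis nc_const_commute mult.assoc)
    then show ?thesis
      by (simp add: E_def sum.distrib sum_distrib_left sum_distrib_right)
  qed
  have D_mult_coeff: "nc_coeff (D (f * g)) w = nc_coeff (D f * g + f * D g) w" for f g w
  proof (induction w arbitrary: f g)
    case Nil
    show ?case
      by (simp add: D_Nil E_mult nc_coeff_const)
  next
    case (Cons x w)
    have "nc_shift x (D f) = nc_shift x (E f) + D (nc_shift x f)" for f
      by (rule ncps_eqI) (simp add: D_Cons)
    then show ?case
      using Cons.IH[of "nc_shift x f" g]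
      by (simp add: D_Cons D_Nil E_mult nc_shift_mult D_add D_smult nc_coeff_mult_Cons
          nc_coeff_const algebra_simps)
  qed
  have D_mult: "D (f * g) = D f * g + f * D g" for f g
    by (rule ncps_eqI) (rule D_mult_coeff)
  have "nc_derivation D"
    unfolding nc_derivation_def using D_add D_smult D_mult by blast
  moreover have "D (nc_var i) = u $ i" for i
  proof -
    have "D 1 = 0"
      using D_mult[of 1 1] by simp
    moreover have "D 0 = 0"
      using D_add[of 0 0] by simp
    ultimately have "D (nc_shift j (nc_var i)) = 0" for j
      by simp
    then show ?thesis
      by (subst D_eq) (simp add: E_def if_distrib[of "(*) _"] cong: if_cong)
  qed
  ultimately show "\<exists>D. nc_derivation D \<and> (\<forall>i. D (nc_var i) = u $ i)"
    by blast
next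
  fix D D' :: "('a, 'n) ncps \<Rightarrow> ('a, 'n) ncps"
  assume D: "nc_derivation D \<and> (\<forall>i. D (nc_var i) = u $ i)"
    and D': "nc_derivation D' \<and> (\<forall>i. D' (nc_var i) = u $ i)"
  show "D = D'"
  proof (rule ext, rule ncps_eqI)
    fix f w
    show "nc_coeff (D f) w = nc_coeff (D' f) w"
    proof (induction w arbitrary: f)
      case Nil
      show ?case
        by (simp add: nc_derivation_unfold[of D u f] nc_derivation_unfold[of D' u f] D D' nc_coeff_var)
    next
      case (Cons x w)
      then show ?case
        by (simp add: nc_derivation_unfold[of D u f] nc_derivation_unfold[of D' u f] D D'
            sum.distrib)
    qed
  qed
qed


section \<open>Vectors of power series\<close>

definition ncv_order :: "('a::zero, 'n::finite) ncps ^ 'n \<Rightarrow> enat" where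
  "ncv_order U = (INF i. nc_order (U $ i))"

definition ncv_map ::
  "('a \<Rightarrow> 'b) \<Rightarrow> ('a, 'n::finite) ncps ^ 'n \<Rightarrow> ('b, 'n) ncps ^ 'n" where
  "ncv_map \<phi> U = (\<chi> i. nc_map \<phi> (U $ i))"

definition ncv_z :: "('a::zero_neq_one, 'n::finite) ncps ^ 'n" where
  "ncv_z = (\<chi> i. nc_var i)"

text \<open>\<open>ncv_subst U V\<close> is \<open>U(V(z))\<close>.\<close>

definition ncv_subst ::
  "('a::comm_ring_1, 'n::finite) ncps ^ 'n \<Rightarrow> ('a, 'n) ncps ^ 'n \<Rightarrow> ('a, 'n) ncps ^ 'n" where
  "ncv_subst U V = (\<chi> i. nc_subst (U $ i) V)"

definition ncv_deriv ::
  "('a::comm_ring_1, 'n::finite) ncps ^ 'n \<Rightarrow> ('a, 'n) ncps ^ 'n \<Rightarrow> ('a, 'n) ncps ^ 'n" where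
  "ncv_deriv u V = (\<chi> i. nc_deriv u (V $ i))"

text \<open>The conditions on the orders ensure that both substitutions make sense.\<close>

definition ncv_inverse_maps ::
  "('a::comm_ring_1, 'n::finite) ncps ^ 'n \<Rightarrow> ('a, 'n) ncps ^ 'n \<Rightarrow> bool" where
  "ncv_inverse_maps F G \<longleftrightarrow>
    ncv_order F \<ge> 1 \<and> ncv_order G \<ge> 1 \<and> ncv_subst F G = ncv_z \<and> ncv_subst G F = ncv_z"


section \<open>The deformation and the recursion\<close>

text \<open>\<open>k[[t]]\<close> is \<open>'a fps\<close>, with \<open>t\<close> being \<open>fps_X\<close>, and \<open>k((t))\<close> is \<open>'a fls\<close>.\<close>

definition F_map :: "('a::comm_ring_1, 'n::finite) ncps ^ 'n \<Rightarrow> ('a fps, 'n) ncps ^ 'n" where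
  "F_map H = ncv_z - nc_const fps_X *s ncv_map fps_const H"

text \<open>For \<open>m \<ge> 1\<close>, the series \<open>N_component N m\<close> over \<open>k\<close> is \<open>N\<^bsub>[m]\<^esub>\<close>, the coefficient of
  \<open>t\<^bsup>m-1\<^esup>\<close> in \<open>N\<close>.\<close>

definition N_component ::
  "('a::zero fps, 'n::finite) ncps ^ 'n \<Rightarrow> nat \<Rightarrow> ('a, 'n) ncps ^ 'n" where
  "N_component N m = ncv_map (\<lambda>c. fps_nth c (m - 1)) N"

text \<open>The relation \<open>M\<^sub>m = 1/(m-1) \<Sum> [M\<^sub>i \<partial>/\<partial>z] M\<^sub>l\<close> (sum over \<open>i + l = m\<close> with \<open>i, l \<ge> 1\<close>) over the
  fraction field of \<open>k\<close>.\<close>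

definition recurrence_at :: "(nat \<Rightarrow> ('a::idom, 'n::finite) ncps ^ 'n) \<Rightarrow> nat \<Rightarrow> bool" where
  "recurrence_at M m \<longleftrightarrow>
    ncv_map to_fract (M m) =
      nc_const (1 / of_nat (m - 1)) *s
        ncv_map to_fract (\<Sum>(i, l)\<in>{(i, l). i + l = m \<and> 1 \<le> i \<and> 1 \<le> l}. ncv_deriv (M i) (M l))"

end

theory Submission
  imports Defs
begin

unbundle no Formal_Power_Series.fps_syntax

text \<open>
  Cancelling \<open>t\<close> in \<open>F\<^sub>t(G\<^sub>t) = z\<close> and \<open>G\<^sub>t(F\<^sub>t) = z\<close> gives \<open>N\<^sub>t = H(G\<^sub>t)\<close> and \<open>N\<^sub>t(F\<^sub>t) = H\<close>. The
  coefficients of \<open>t\<^bsup>m-1\<^esup>\<close> in the latter are the residue formula. For the recursion, let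
  \<open>L(V)\<close> be the derivative of \<open>H\<close> at \<open>G\<^sub>t\<close> in direction \<open>V\<close>. Both \<open>D = \<partial>/\<partial>t\<close> and
  \<open>D = [N\<^sub>t \<partial>/\<partial>z]\<close> satisfy the chain rule \<open>D N\<^sub>t = L(D G\<^sub>t)\<close> and \<open>D G\<^sub>t = N\<^sub>t + t D N\<^sub>t\<close>. Hence the
  difference \<open>X\<close> of the two values of \<open>D N\<^sub>t\<close> satisfies \<open>X = t L(X)\<close>, so it is divisible by every
  power of \<open>t\<close> and vanishes. The recursion compares coefficients of \<open>t\<close> in
  \<open>\<partial>N\<^sub>t/\<partial>t = [N\<^sub>t \<partial>/\<partial>z] N\<^sub>t\<close>.
\<close>

section \<open>Constant terms, words of bounded length and cancellation of \<open>t\<close>\<close>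

lemma ncps_eq_iff: "f = g \<longleftrightarrow> (\<forall>w. nc_coeff f w = nc_coeff g w)"
  by (auto intro: ncps_eqI)

lemma ncv_order_ge_1D:
  assumes "ncv_order U \<ge> 1"
  shows "nc_coeff (U $ i) [] = 0"
proof (rule ccontr)
  assume "nc_coeff (U $ i) [] \<noteq> 0"
  then have "nc_order (U $ i) \<le> enat (length ([] :: 'b list))"
    unfolding nc_order_def by (intro INF_lower) simp
  moreover have "ncv_order U \<le> nc_order (U $ i)"
    unfolding ncv_order_def by (rule INF_lower) simp
  ultimately have "1 \<le> (0 :: enat)"
    using assms by (metis list.size(3) order_trans zero_enat_def)
  then show False
    by simp
qed

lemma finite_words_le: "finite {v :: 'n::finite list. length v \<le> k}"
  using finite_lists_length_le[of "UNIV :: 'n set" k] by simp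

lemma nc_mult_const_left: "f * (nc_const c * g) = nc_const c * (f * g)"
  by (metis nc_const_commute mult.assoc)

lemma nc_const_X_cancel:
  fixes f g :: "('a::idom fps, 'n) ncps"
  assumes "nc_const fps_X * f = nc_const fps_X * g"
  shows "f = g"
proof (rule ncps_eqI)
  fix w
  have "fps_X * nc_coeff f w = fps_X * nc_coeff g w"
    using assms by (metis nc_coeff_const_mult)
  then show "nc_coeff f w = nc_coeff g w"
    by simp
qed

lemma nc_coeff_mult_cong:
  assumes "\<And>v. length v \<le> length w \<Longrightarrow> nc_coeff g v = nc_coeff h v"
  shows "nc_coeff (f * g) w = nc_coeff (f * h) w"
  using assms by (simp add: nc_coeff_mult)

text \<open>In every splitting of \<open>w\<close>, either the left factor is empty, where
  \<open>f\<close> vanishes, or the right factor is shorter than \<open>w\<close>, where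
  \<open>g\<close> vanishes.\<close>

lemma nc_coeff_mult_eq_0:
  assumes "nc_coeff f [] = 0" and "\<And>v. length v < length w \<Longrightarrow> nc_coeff g v = 0"
  shows "nc_coeff (f * g) w = 0"
proof -
  have "nc_coeff f (take j w) * nc_coeff g (drop j w) = 0" if "j \<le> length w" for j
    using assms that by (cases "j = 0") auto
  then show ?thesis
    by (simp add: nc_coeff_mult)
qed


section \<open>Substitution\<close>

abbreviation nc_monom :: "('a::comm_ring_1, 'n::finite) ncps ^ 'n \<Rightarrow> 'n list \<Rightarrow> ('a, 'n) ncps" where
  "nc_monom U v \<equiv> prod_list (map (\<lambda>i. U $ i) v)"

lemma nc_coeff_monom_eq_0:
  assumes "\<And>i. nc_coeff (U $ i) [] = 0" and "length w < length v"
  shows "nc_coeff (nc_monom U v) w = 0"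
  using assms(2)
proof (induction v arbitrary: w)
  case (Cons i v)
  have "nc_coeff (U $ i * nc_monom U v) w = 0"
    by (rule nc_coeff_mult_eq_0) (use Cons assms(1) in auto)
  then show ?case
    by simp
qed simp

text \<open>Monomials longer than \<open>w\<close> contribute nothing, so the bound in
  \<open>nc_subst\<close> may be enlarged. This lets one range of summation serve several words
  \<open>w\<close> at once.\<close>

lemma nc_coeff_subst:
  assumes "\<And>i. nc_coeff (U $ i) [] = 0" and "length w \<le> k"
  shows "nc_coeff (nc_subst f U) w =
    (\<Sum>v\<in>{v. length v \<le> k}. nc_coeff f v * nc_coeff (nc_monom U v) w)"
  unfolding nc_subst_def nc_coeff_Abs
  by (rule sum.mono_neutral_left)
    (use assms finite_words_le in \<open>auto simp: nc_coeff_monom_eq_0\<close>)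

lemma nc_subst_add: "nc_subst (f + g) U = nc_subst f U + nc_subst g U"
  by (rule ncps_eqI) (simp add: nc_subst_def distrib_right sum.distrib)

lemma nc_subst_diff: "nc_subst (f - g) U = nc_subst f U - nc_subst g U"
  by (rule ncps_eqI) (simp add: nc_subst_def left_diff_distrib sum_subtractf)

lemma nc_subst_const_mult: "nc_subst (nc_const c * f) U = nc_const c * nc_subst f U"
  by (rule ncps_eqI) (simp add: nc_subst_def sum_distrib_left mult.assoc)

lemma nc_subst_var:
  assumes "\<And>i. nc_coeff (U $ i) [] = 0"
  shows "nc_subst (nc_var i) U = U $ i"
proof (rule ncps_eqI)
  fix w
  \<comment> \<open>The bound \<open>Suc (length w)\<close> keeps the word \<open>[i]\<close> in the
    range even when \<open>w\<close> is empty.\<close>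
  have "nc_coeff (nc_subst (nc_var i) U) w =
      (\<Sum>v\<in>{v. length v \<le> Suc (length w)}. if v = [i] then nc_coeff (nc_monom U v) w else 0)"
    by (subst nc_coeff_subst[where k = "Suc (length w)"])
      (auto simp: assms nc_coeff_var intro!: sum.cong)
  then show "nc_coeff (nc_subst (nc_var i) U) w = nc_coeff (U $ i) w"
    by (simp add: finite_words_le)
qed

text \<open>Modulo \<open>t\<close> the map \<open>z + tV\<close> is the identity, so its monomial
  for \<open>v\<close> reduces to the word \<open>v\<close>.\<close>

lemma fps_nth_0_nc_coeff_monom:
  "fps_nth (nc_coeff (nc_monom (ncv_z + nc_const fps_X *s V) v) w) 0 = (if w = v then 1 else 0)"
proof (induction v arbitrary: w)
  case (Cons i v)
  show ?case
  proof (cases w)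
    case (Cons x u)
    have "fps_nth (nc_coeff ((nc_var i + nc_const fps_X * V $ i) *
        nc_monom (ncv_z + nc_const fps_X *s V) v) w) 0 =
        fps_nth (nc_coeff (nc_var i * nc_monom (ncv_z + nc_const fps_X *s V) v) w) 0"
      by (simp add: distrib_right mult.assoc)
    then show ?thesis
      using Cons Cons.IH[of u] by (auto simp: ncv_z_def)
  qed (simp add: ncv_z_def nc_coeff_var nc_coeff_const)
qed auto

text \<open>Serves twice: with \<open>V = N\<close> it identifies the first component, and with
  \<open>V = -H\<close> it isolates \<open>N_[m]\<close> in the residue formula.\<close>

lemma fps_nth_0_nc_coeff_subst:
  "fps_nth (nc_coeff (nc_subst f (ncv_z + nc_const fps_X *s V)) w) 0 = fps_nth (nc_coeff f w) 0"
  by (simp add: nc_subst_def fps_sum_nth fps_nth_0_nc_coeff_monom finite_words_le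
      if_distrib[of "(*) _"] cong: if_cong del: vector_add_component vector_smult_component)

text \<open>Only \<open>f\<close> is expanded in powers of \<open>t\<close>; \<open>U\<close> keeps
  its dependence on \<open>t\<close>. This is the shape of the terms
  \<open>N_[l](z - tH)\<close>.\<close>

lemma fps_nth_nc_coeff_subst:
  "fps_nth (nc_coeff (nc_subst f U) w) m =
    (\<Sum>j\<le>m. fps_nth (nc_coeff
      (nc_subst (nc_map fps_const (nc_map (\<lambda>c. fps_nth c j) f)) U) w) (m - j))"
proof -
  have "fps_nth (nc_coeff (nc_subst f U) w) m =
      (\<Sum>v\<in>{v. length v \<le> length w}. \<Sum>j\<le>m.
        fps_nth (nc_coeff f v) j * fps_nth (nc_coeff (nc_monom U v) w) (m - j))"
    by (simp add: nc_subst_def fps_sum_nth fps_mult_nth atLeast0AtMost)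
  also have "\<dots> = (\<Sum>j\<le>m. \<Sum>v\<in>{v. length v \<le> length w}.
        fps_nth (nc_coeff f v) j * fps_nth (nc_coeff (nc_monom U v) w) (m - j))"
    by (rule sum.swap)
  finally show ?thesis
    by (simp add: nc_subst_def fps_sum_nth)
qed


section \<open>The chain rule\<close>

text \<open>The derivative of the monomial of a word at \<open>U\<close> in direction
  \<open>V\<close>: the sum over its positions, with the factor from \<open>U\<close> replaced there
  by the one from \<open>V\<close>.\<close>

primrec nc_dmonom ::
  "('a::comm_ring_1, 'n::finite) ncps ^ 'n \<Rightarrow> ('a, 'n) ncps ^ 'n \<Rightarrow> 'n list \<Rightarrow> ('a, 'n) ncps" where
  "nc_dmonom U V [] = 0"
| "nc_dmonom U V (i # v) = V $ i * nc_monom U v + U $ i * nc_dmonom U V v"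

text \<open>The derivative of \<open>f\<close> at \<open>U\<close> in direction \<open>V\<close>, for \<open>U\<close> of order at least 1. Since \<open>V\<close> may
  have constant terms, words of length up to \<open>Suc (length w)\<close> contribute.\<close>

definition nc_dsubst :: "('a::comm_ring_1, 'n::finite) ncps \<Rightarrow> ('a, 'n) ncps ^ 'n \<Rightarrow>
    ('a, 'n) ncps ^ 'n \<Rightarrow> ('a, 'n) ncps" where
  "nc_dsubst f U V = Abs_ncps (\<lambda>w. \<Sum>v\<in>{v. length v \<le> Suc (length w)}.
    nc_coeff f v * nc_coeff (nc_dmonom U V v) w)"

lemma nc_dmonom_add: "nc_dmonom U (V + W) v = nc_dmonom U V v + nc_dmonom U W v"
  by (induction v) (simp_all add: algebra_simps)

lemma nc_dmonom_diff: "nc_dmonom U (V - W) v = nc_dmonom U V v - nc_dmonom U W v"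
  by (induction v) (simp_all add: left_diff_distrib right_diff_distrib)

lemma nc_dmonom_smult: "nc_dmonom U (nc_const c *s V) v = nc_const c * nc_dmonom U V v"
  by (induction v) (simp_all add: nc_mult_const_left distrib_left mult.assoc)

lemma nc_dsubst_add: "nc_dsubst f U (V + W) = nc_dsubst f U V + nc_dsubst f U W"
  by (rule ncps_eqI) (simp add: nc_dsubst_def nc_dmonom_add distrib_left sum.distrib)

lemma nc_dsubst_diff: "nc_dsubst f U (V - W) = nc_dsubst f U V - nc_dsubst f U W"
  by (rule ncps_eqI) (simp add: nc_dsubst_def nc_dmonom_diff right_diff_distrib sum_subtractf)

lemma nc_dsubst_smult: "nc_dsubst f U (nc_const c *s V) = nc_const c * nc_dsubst f U V"
  by (rule ncps_eqI) (simp add: nc_dsubst_def nc_dmonom_smult sum_distrib_left mult.left_commute)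

text \<open>Only the Leibniz rule is assumed, so that the coefficientwise \<open>fps_deriv\<close>
  is covered as well: it is not linear over \<open>k[[t]]\<close>, hence no
  \<open>nc_derivation\<close>.\<close>

lemma leibniz_nc_monom:
  assumes mult: "\<And>f g. D (f * g) = D f * g + f * D g"
  shows "D (nc_monom U v) = nc_dmonom U (\<chi> i. D (U $ i)) v"
proof (induction v)
  case Nil
  show ?case
    using mult[of 1 1] by simp
qed (simp add: mult)

lemma nc_deriv_props:
  shows nc_derivation_nc_deriv: "nc_derivation (nc_deriv u)"
    and nc_deriv_var: "nc_deriv u (nc_var i) = u $ i"
  using theI'[OF nc_deriv_ex1[of u]] unfolding nc_deriv_def by blast+

lemma nc_deriv_add: "nc_deriv u (f + g) = nc_deriv u f + nc_deriv u g"
  and nc_deriv_const_mult: "nc_deriv u (nc_const c * f) = nc_const c * nc_deriv u f"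
  and nc_deriv_mult: "nc_deriv u (f * g) = nc_deriv u f * g + f * nc_deriv u g"
  using nc_derivation_nc_deriv[of u] unfolding nc_derivation_def by blast+

lemma nc_deriv_unfold:
  "nc_deriv u f = (\<Sum>i\<in>UNIV. u $ i * nc_shift i f + nc_var i * nc_deriv u (nc_shift i f))"
  by (rule nc_derivation_unfold) (simp_all add: nc_derivation_nc_deriv nc_deriv_var)

lemma nc_coeff_deriv_Nil:
  "nc_coeff (nc_deriv u f) [] = (\<Sum>i\<in>UNIV. nc_coeff (u $ i * nc_shift i f) [])"
  by (subst nc_deriv_unfold) (simp add: nc_coeff_var)

lemma nc_coeff_deriv_Cons:
  "nc_coeff (nc_deriv u f) (x # w) =
    (\<Sum>i\<in>UNIV. nc_coeff (u $ i * nc_shift i f) (x # w)) + nc_coeff (nc_deriv u (nc_shift x f)) w"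
  by (subst nc_deriv_unfold) (simp add: sum.distrib)

text \<open>A derivation lowers the degree by at most one, which happens when \<open>u\<close> has
  constant terms; hence the bound \<open>Suc (length w)\<close>.\<close>

lemma nc_coeff_deriv_cong:
  assumes "\<And>v. length v \<le> Suc (length w) \<Longrightarrow> nc_coeff f v = nc_coeff g v"
  shows "nc_coeff (nc_deriv u f) w = nc_coeff (nc_deriv u g) w"
  using assms
proof (induction w arbitrary: f g)
  case (Cons x w)
  have "nc_coeff (u $ i * nc_shift i f) (x # w) = nc_coeff (u $ i * nc_shift i g) (x # w)" for i
    by (rule nc_coeff_mult_cong) (use Cons.prems in auto)
  moreover have "nc_coeff (nc_deriv u (nc_shift x f)) w = nc_coeff (nc_deriv u (nc_shift x g)) w"
    by (rule Cons.IH) (use Cons.prems in auto)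
  ultimately show ?case
    by (simp add: nc_coeff_deriv_Cons)
qed (simp add: nc_coeff_deriv_Nil)

lemma nc_deriv_subst:
  fixes U :: "('a::comm_ring_1, 'n::finite) ncps ^ 'n"
  assumes U: "\<And>i. nc_coeff (U $ i) [] = 0"
  shows "nc_deriv u (nc_subst f U) = nc_dsubst f U (ncv_deriv u U)"
proof (rule ncps_eqI)
  fix w :: "'n list"
  let ?S = "{v :: 'n list. length v \<le> Suc (length w)}"
  \<comment> \<open>A derivation is only known to commute with finite sums, so the substitution is
    first truncated to the words that can influence the coefficient of \<open>w\<close>.\<close>
  have "nc_coeff (nc_deriv u (nc_subst f U)) w =
      nc_coeff (nc_deriv u (\<Sum>v\<in>?S. nc_const (nc_coeff f v) * nc_monom U v)) w"
    by (rule nc_coeff_deriv_cong) (simp add: nc_coeff_subst[OF U, of _ "Suc (length w)"])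
  then show "nc_coeff (nc_deriv u (nc_subst f U)) w = nc_coeff (nc_dsubst f U (ncv_deriv u U)) w"
    by (simp add: nc_derivation_sum[OF nc_derivation_nc_deriv] nc_deriv_const_mult
        leibniz_nc_monom[of "nc_deriv u", OF nc_deriv_mult] nc_dsubst_def ncv_deriv_def)
qed

lemma nc_map_fps_deriv_mult:
  "nc_map fps_deriv (f * g) = nc_map fps_deriv f * g + f * nc_map fps_deriv g"
  by (rule ncps_eqI)
    (simp add: nc_coeff_mult fps_deriv_sum sum.distrib[symmetric] add.commute)

text \<open>The coefficients of \<open>nc_map fps_const f\<close> are free of \<open>t\<close>, so
  differentiation acts on \<open>U\<close> alone.\<close>

lemma nc_map_fps_deriv_subst:
  assumes U: "\<And>i. nc_coeff (U $ i) [] = 0"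
  shows "nc_map fps_deriv (nc_subst (nc_map fps_const f) U) =
    nc_dsubst (nc_map fps_const f) U (ncv_map fps_deriv U)"
proof (rule ncps_eqI)
  fix w
  have "fps_deriv (nc_coeff (nc_monom U v) w) = nc_coeff (nc_dmonom U (ncv_map fps_deriv U) v) w"
    for v
    using leibniz_nc_monom[of "nc_map fps_deriv" U v, OF nc_map_fps_deriv_mult]
    by (metis ncv_map_def nc_coeff_map)
  then show "nc_coeff (nc_map fps_deriv (nc_subst (nc_map fps_const f) U)) w =
      nc_coeff (nc_dsubst (nc_map fps_const f) U (ncv_map fps_deriv U)) w"
    by (simp add: nc_coeff_subst[OF U, of w "Suc (length w)"] nc_dsubst_def fps_deriv_sum)
qed


section \<open>The evolution equation\<close>

text \<open>By linearity in the direction, a factor \<open>t^k\<close> of \<open>X\<close> passes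
  through \<open>nc_dsubst\<close>, and the equation supplies one more \<open>t\<close>.\<close>

lemma ncv_eq_0_if_X_smult_fixed:
  fixes X :: "('a::comm_ring_1 fps, 'n::finite) ncps ^ 'n"
  assumes "X = (\<chi> i. nc_const fps_X * nc_dsubst (f $ i) U X)"
  shows "X = 0"
proof -
  have *: "\<exists>Y. X = nc_const (fps_X ^ k) *s Y" for k
  proof (induction k)
    case 0
    have "X = nc_const (fps_X ^ 0) *s X"
      by (simp flip: one_ncps_def)
    then show ?case ..
  next
    case (Suc k)
    then obtain Y where "X = nc_const (fps_X ^ k) *s Y"
      by blast
    then have "nc_dsubst (f $ i) U X = nc_const (fps_X ^ k) * nc_dsubst (f $ i) U Y" for i
      by (simp add: nc_dsubst_smult)
    with assms have "X = nc_const (fps_X ^ Suc k) *s (\<chi> i. nc_dsubst (f $ i) U Y)"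
      by (auto simp: vec_eq_iff mult.assoc intro!: ncps_eqI)
    then show ?case ..
  qed
  have "nc_coeff (X $ i) w = 0" for i w
  proof (rule fps_ext)
    fix k
    obtain Y where "X = nc_const (fps_X ^ Suc k) *s Y"
      using * by blast
    then have "nc_coeff (X $ i) w = fps_X ^ Suc k * nc_coeff (Y $ i) w"
      by (metis nc_coeff_const_mult vector_smult_component)
    then show "fps_nth (nc_coeff (X $ i) w) k = fps_nth 0 k"
      by (simp only: fps_X_power_mult_nth) simp
  qed
  then show ?thesis
    by (simp add: vec_eq_iff ncps_eqI)
qed

text \<open>The order conditions in \<open>ncv_inverse_maps\<close> make the constant terms vanish,
  as \<open>nc_subst_var\<close> requires; expanding the outer map then leaves an equation with a
  common factor \<open>t\<close>.\<close>

lemma inverse_maps_F_mapD: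
  fixes H :: "('a::idom, 'n::finite) ncps ^ 'n"
  assumes "ncv_inverse_maps (F_map H) (ncv_z + nc_const fps_X *s N)"
  shows "\<And>i. nc_coeff ((ncv_z + nc_const fps_X *s N) $ i) [] = 0"
    and "\<And>i. N $ i = nc_subst (nc_map fps_const (H $ i)) (ncv_z + nc_const fps_X *s N)"
    and "\<And>i. nc_subst (N $ i) (F_map H) = nc_map fps_const (H $ i)"
proof -
  let ?F = "F_map H" and ?G = "ncv_z + nc_const fps_X *s N"
  have F: "?F $ i = nc_var i - nc_const fps_X * nc_map fps_const (H $ i)" for i
    by (simp add: F_map_def ncv_z_def ncv_map_def)
  have G: "?G $ i = nc_var i + nc_const fps_X * N $ i" for i
    by (simp add: ncv_z_def)
  show G0: "nc_coeff (?G $ i) [] = 0" for i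
    using assms by (intro ncv_order_ge_1D) (simp add: ncv_inverse_maps_def)
  have F0: "nc_coeff (?F $ i) [] = 0" for i
    using assms by (intro ncv_order_ge_1D) (simp add: ncv_inverse_maps_def)
  show "N $ i = nc_subst (nc_map fps_const (H $ i)) ?G" for i
  proof (rule nc_const_X_cancel)
    have "nc_subst (?F $ i) ?G = nc_var i"
      using assms by (simp add: ncv_inverse_maps_def ncv_subst_def ncv_z_def vec_eq_iff)
    moreover have "nc_subst (?F $ i) ?G =
        ?G $ i - nc_const fps_X * nc_subst (nc_map fps_const (H $ i)) ?G"
      unfolding F nc_subst_diff nc_subst_const_mult nc_subst_var[OF G0] ..
    ultimately show "nc_const fps_X * N $ i =
        nc_const fps_X * nc_subst (nc_map fps_const (H $ i)) ?G"
      unfolding G by simp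
  qed
  show "nc_subst (N $ i) ?F = nc_map fps_const (H $ i)" for i
  proof (rule nc_const_X_cancel)
    have "nc_subst (?G $ i) ?F = nc_var i"
      using assms by (simp add: ncv_inverse_maps_def ncv_subst_def ncv_z_def vec_eq_iff)
    moreover have "nc_subst (?G $ i) ?F = ?F $ i + nc_const fps_X * nc_subst (N $ i) ?F"
      unfolding G nc_subst_add nc_subst_const_mult nc_subst_var[OF F0] ..
    ultimately show "nc_const fps_X * nc_subst (N $ i) ?F =
        nc_const fps_X * nc_map fps_const (H $ i)"
      unfolding F by (simp add: algebra_simps)
  qed
qed

lemma evolution_equation:
  fixes H :: "('a::comm_ring_1, 'n::finite) ncps ^ 'n"
  assumes G0: "\<And>i. nc_coeff ((ncv_z + nc_const fps_X *s N) $ i) [] = 0"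
    and N: "\<And>i. N $ i = nc_subst (nc_map fps_const (H $ i)) (ncv_z + nc_const fps_X *s N)"
  shows "ncv_map fps_deriv N = ncv_deriv N N"
proof -
  let ?G = "ncv_z + nc_const fps_X *s N"
  let ?L = "\<lambda>i. nc_dsubst (nc_map fps_const (H $ i)) ?G"
  have "ncv_map fps_deriv ?G = N + nc_const fps_X *s ncv_map fps_deriv N"
    by (auto simp: vec_eq_iff ncv_map_def ncv_z_def nc_coeff_var add.commute intro!: ncps_eqI)
  then have t: "ncv_map fps_deriv N $ i =
      ?L i N + nc_const fps_X * ?L i (ncv_map fps_deriv N)" for i
    using nc_map_fps_deriv_subst[OF G0, of "H $ i"]
    by (simp add: ncv_map_def nc_dsubst_add nc_dsubst_smult flip: N)
  have "ncv_deriv N ?G = N + nc_const fps_X *s ncv_deriv N N"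
    by (simp add: vec_eq_iff ncv_deriv_def ncv_z_def nc_deriv_add nc_deriv_const_mult nc_deriv_var)
  then have z: "ncv_deriv N N $ i = ?L i N + nc_const fps_X * ?L i (ncv_deriv N N)" for i
    using nc_deriv_subst[OF G0, of N "nc_map fps_const (H $ i)"]
    by (simp add: ncv_deriv_def nc_dsubst_add nc_dsubst_smult flip: N)
  \<comment> \<open>The terms \<open>?L i N\<close> cancel in the difference of \<open>t\<close> and
    \<open>z\<close>.\<close>
  have "ncv_map fps_deriv N - ncv_deriv N N = 0"
    by (rule ncv_eq_0_if_X_smult_fixed[of _ "ncv_map fps_const H" ?G])
      (simp add: vec_eq_iff t z nc_dsubst_diff right_diff_distrib ncv_map_def[of fps_const])
  then show ?thesis
    by simp
qed


section \<open>Comparison of coefficients of \<open>t\<close>\<close>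

lemma fps_nth_nc_coeff_mult:
  "fps_nth (nc_coeff (f * g) w) m =
    (\<Sum>j\<le>m. nc_coeff (nc_map (\<lambda>c. fps_nth c j) f * nc_map (\<lambda>c. fps_nth c (m - j)) g) w)"
  unfolding nc_coeff_mult fps_sum_nth fps_mult_nth atLeast0AtMost nc_coeff_map
  by (rule sum.swap)

lemma nc_map_shift: "nc_map \<phi> (nc_shift i f) = nc_shift i (nc_map \<phi> f)"
  by (rule ncps_eqI) simp

text \<open>A Cauchy product, since \<open>[u d/dz] f\<close> is bilinear in \<open>u\<close> and
  \<open>f\<close>. The induction follows the recursion of the coefficients along
  \<open>w\<close>.\<close>

lemma fps_nth_nc_coeff_deriv:
  "fps_nth (nc_coeff (nc_deriv u f) w) m =
    (\<Sum>j\<le>m. nc_coeff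
      (nc_deriv (ncv_map (\<lambda>c. fps_nth c j) u) (nc_map (\<lambda>c. fps_nth c (m - j)) f)) w)"
proof -
  have *: "(\<Sum>i\<in>UNIV. fps_nth (nc_coeff (u $ i * nc_shift i f) w) m) =
      (\<Sum>j\<le>m. \<Sum>i\<in>UNIV. nc_coeff (ncv_map (\<lambda>c. fps_nth c j) u $ i *
        nc_shift i (nc_map (\<lambda>c. fps_nth c (m - j)) f)) w)" for f w
    unfolding fps_nth_nc_coeff_mult nc_map_shift ncv_map_def vec_lambda_beta by (rule sum.swap)
  show ?thesis
  proof (induction w arbitrary: f)
    case Nil
    show ?case
      unfolding nc_coeff_deriv_Nil fps_sum_nth by (rule *)
  next
    case (Cons x w)
    show ?case
      unfolding nc_coeff_deriv_Cons fps_add_nth fps_sum_nth * Cons.IH sum.distrib nc_map_shift ..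
  qed
qed

text \<open>This is the coefficient of \<open>t^(m-2)\<close> in the evolution equation:
  \<open>N_[m]\<close> sits at \<open>t^(m-1)\<close>, so differentiation produces the factor
  \<open>m - 1\<close>.\<close>

lemma smult_N_component:
  assumes "ncv_map fps_deriv N = ncv_deriv N N" and "m \<ge> 2"
  shows "nc_const (of_nat (m - 1)) *s N_component N m =
    (\<Sum>(i, l)\<in>{(i, l). i + l = m \<and> 1 \<le> i \<and> 1 \<le> l}. ncv_deriv (N_component N i) (N_component N l))"
proof -
  obtain k where m: "m = k + 2"
    using \<open>m \<ge> 2\<close> by (metis add.commute le_Suc_ex)
  have "(\<Sum>(i, l)\<in>{(i, l). i + l = m \<and> 1 \<le> i \<and> 1 \<le> l}.
        ncv_deriv (N_component N i) (N_component N l)) =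
      (\<Sum>j\<le>k. ncv_deriv (N_component N (Suc j)) (N_component N (Suc (k - j))))"
    \<comment> \<open>The component \<open>N_[i]\<close> has exponent \<open>j = i - 1\<close>, and
      \<open>i + l = m\<close> becomes a total exponent \<open>k = m - 2\<close>.\<close>
    by (rule sum.reindex_bij_witness[of _ "\<lambda>j. (Suc j, Suc (k - j))" "\<lambda>(i, l). i - 1"])
      (auto simp: m intro!: arg_cong2[where f = ncv_deriv] arg_cong2[where f = N_component])
  moreover have "nc_coeff ((nc_const (of_nat (m - 1)) *s N_component N m) $ r) w =
      nc_coeff ((\<Sum>j\<le>k. ncv_deriv (N_component N (Suc j)) (N_component N (Suc (k - j)))) $ r) w"
    for r w
  proof -
    have "fps_deriv (nc_coeff (N $ r) w) = nc_coeff (nc_deriv N (N $ r)) w"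
      using assms(1) by (simp add: vec_eq_iff ncps_eq_iff ncv_map_def ncv_deriv_def)
    then have "of_nat (Suc k) * fps_nth (nc_coeff (N $ r) w) (Suc k) =
        fps_nth (nc_coeff (nc_deriv N (N $ r)) w) k"
      by (metis fps_deriv_nth Suc_eq_plus1)
    then show ?thesis
      unfolding fps_nth_nc_coeff_deriv
      by (simp add: m N_component_def ncv_deriv_def ncv_map_def)
  qed
  ultimately show ?thesis
    by (simp add: vec_eq_iff ncps_eqI)
qed

section \<open>The recursion over the fraction field\<close>

text \<open>The embedding into the fraction field is injective, so the nonzero denominator can be
  cleared.\<close>

lemma recurrence_at_iff:
  fixes M :: "nat \<Rightarrow> ('a::idom, 'n::finite) ncps ^ 'n"
  assumes "of_nat (m - 1) \<noteq> (0 :: 'a)"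
  shows "recurrence_at M m \<longleftrightarrow> nc_const (of_nat (m - 1)) *s M m =
    (\<Sum>(i, l)\<in>{(i, l). i + l = m \<and> 1 \<le> i \<and> 1 \<le> l}. ncv_deriv (M i) (M l))"
    (is "_ \<longleftrightarrow> _ = ?S")
proof -
  let ?c = "of_nat (m - 1) :: 'a"
  have fract: "of_nat (m - 1) = to_fract ?c"
    by (simp only: of_nat_fract to_fract_def)
  have "to_fract x = 1 / of_nat (m - 1) * to_fract y \<longleftrightarrow> ?c * x = y" for x y :: 'a
  proof -
    have "a = 1 / c * b \<longleftrightarrow> c * a = b" if "c \<noteq> 0" for a b c :: "'a fract"
      using that by (auto simp: field_simps)
    from this[of "to_fract ?c"] show ?thesis
      using assms
      by (simp only: fract to_fract_eq_iff to_fract_eq_0_iff not_False_eq_True flip: to_fract_mult)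
  qed
  then have "nc_map to_fract f = nc_const (1 / of_nat (m - 1)) * nc_map to_fract g \<longleftrightarrow>
      nc_const (of_nat (m - 1)) * f = g" for f g :: "('a, 'n) ncps"
    by (simp only: ncps_eq_iff nc_coeff_map nc_coeff_const_mult)
  then show ?thesis
    by (simp add: recurrence_at_def vec_eq_iff ncv_map_def)
qed

text \<open>Both indices on the right-hand side are below \<open>m\<close>, so strong induction
  applies; injectivity of \<open>to_fract\<close> brings the equality back to
  \<open>k\<close>.\<close>

lemma recurrence_unique:
  fixes M M' :: "nat \<Rightarrow> ('a::idom, 'n::finite) ncps ^ 'n"
  assumes "M 1 = M' 1" and "\<forall>m\<ge>2. recurrence_at M m" and "\<forall>m\<ge>2. recurrence_at M' m"
    and "m \<ge> 1"
  shows "M m = M' m"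
  using \<open>m \<ge> 1\<close>
proof (induction m rule: less_induct)
  case (less m)
  show ?case
  proof (cases "m = 1")
    case False
    with less.prems have "m \<ge> 2"
      by simp
    have "(\<Sum>(i, l)\<in>{(i, l). i + l = m \<and> 1 \<le> i \<and> 1 \<le> l}. ncv_deriv (M i) (M l)) =
        (\<Sum>(i, l)\<in>{(i, l). i + l = m \<and> 1 \<le> i \<and> 1 \<le> l}. ncv_deriv (M' i) (M' l))"
      by (rule sum.cong) (auto simp: less.IH)
    with assms(2,3) \<open>m \<ge> 2\<close> have "ncv_map to_fract (M m) = ncv_map to_fract (M' m)"
      by (simp add: recurrence_at_def)
    then show ?thesis
      by (simp add: vec_eq_iff ncps_eq_iff ncv_map_def)
  qed (use assms(1) in simp)
qed

section \<open>The first component and the residue formula\<close>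

lemma N_component_1:
  assumes "\<And>i. N $ i = nc_subst (nc_map fps_const (H $ i)) (ncv_z + nc_const fps_X *s N)"
  shows "N_component N 1 = H"
proof -
  have "fps_nth (nc_coeff (N $ i) w) 0 = nc_coeff (H $ i) w" for i w
    by (subst assms) (simp add: fps_nth_0_nc_coeff_subst)
  then show ?thesis
    by (auto simp: vec_eq_iff N_component_def ncv_map_def intro!: ncps_eqI)
qed

lemma fls_residue_intpow_mult:
  fixes c :: "'a::comm_ring_1 fps"
  assumes "l \<le> m"
  shows "fls_residue (fls_X_intpow (int l - int m - 1) * fps_to_fls c) = fps_nth c (m - l)"
  unfolding fls_X_intpow_times_conv_shift using assms by (simp add: nat_diff_distrib)

text \<open>Since \<open>H\<close> is free of \<open>t\<close> and \<open>m \<ge> 2\<close>, the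
  coefficient of \<open>t^(m-1)\<close> in \<open>N_t(F_t)\<close> vanishes. Its summand for
  \<open>l = m\<close> is \<open>N_[m](F_t)\<close> at \<open>t = 0\<close>, which is
  \<open>N_[m]\<close>; the others give the residues.\<close>

lemma N_component_residue:
  fixes H :: "('a::comm_ring_1, 'n::finite) ncps ^ 'n"
  assumes N: "\<And>i. nc_subst (N $ i) (F_map H) = nc_map fps_const (H $ i)" and "m \<ge> 2"
  shows "N_component N m = - ncv_map fls_residue (\<Sum>l = 1..m - 1.
    nc_const (fls_X_intpow (int l - int m - 1)) *s
      ncv_map fps_to_fls (ncv_subst (ncv_map fps_const (N_component N l)) (F_map H)))"
proof -
  obtain k where m: "m = Suc (Suc k)"
    using \<open>m \<ge> 2\<close> by (metis add_2_eq_Suc le_Suc_ex)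
  have "nc_coeff (N_component N m $ i) w = - fls_residue (nc_coeff ((\<Sum>l = 1..m - 1.
    nc_const (fls_X_intpow (int l - int m - 1)) *s
      ncv_map fps_to_fls (ncv_subst (ncv_map fps_const (N_component N l)) (F_map H))) $ i) w)"
    for i w
  proof -
    define c where "c l = nc_coeff (nc_subst (nc_map fps_const (N_component N l $ i)) (F_map H)) w"
      for l
    \<comment> \<open>This form allows reduction modulo \<open>t\<close> with direction
      \<open>-H\<close>.\<close>
    have "F_map H = ncv_z + nc_const fps_X *s - ncv_map fps_const H"
      by (simp add: F_map_def vec_eq_iff)
    then have c0: "fps_nth (c m) 0 = nc_coeff (N_component N m $ i) w"
      by (simp add: c_def fps_nth_0_nc_coeff_subst)
    have "0 = fps_nth (nc_coeff (nc_subst (N $ i) (F_map H)) w) (Suc k)"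
      by (simp add: N)
    also have "\<dots> = (\<Sum>j\<le>Suc k. fps_nth (c (Suc j)) (Suc k - j))"
      by (subst fps_nth_nc_coeff_subst) (simp add: c_def N_component_def ncv_map_def)
    also have "\<dots> = (\<Sum>j\<le>k. fps_nth (c (Suc j)) (Suc k - j)) + fps_nth (c m) 0"
      by (simp add: m)
    also have "(\<Sum>j\<le>k. fps_nth (c (Suc j)) (Suc k - j)) = (\<Sum>l = 1..m - 1. fps_nth (c l) (m - l))"
      by (rule sum.reindex_bij_witness[of _ "\<lambda>l. l - 1" Suc]) (auto simp: m)
    also have "\<dots> = (\<Sum>l = 1..m - 1.
        fls_residue (fls_X_intpow (int l - int m - 1) * fps_to_fls (c l)))"
      by (intro sum.cong refl fls_residue_intpow_mult[symmetric]) auto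
    finally have "fps_nth (c m) 0 = - (\<Sum>l = 1..m - 1.
        fls_residue (fls_X_intpow (int l - int m - 1) * fps_to_fls (c l)))"
      by (rule add_eq_0_iff[THEN iffD1, OF sym])
    then show ?thesis
      unfolding c0 by (simp add: c_def fls_nth_sum ncv_map_def ncv_subst_def)
  qed
  then show ?thesis
    by (auto simp: vec_eq_iff ncv_map_def intro!: ncps_eqI)
qed

theorem theorem5p5:
  fixes H :: "('a::idom, 'n::finite) ncps ^ 'n"
    and N :: "('a fps, 'n) ncps ^ 'n"
  assumes "ncv_order H \<ge> 2"
    and "ncv_inverse_maps (F_map H) (ncv_z + nc_const fps_X *s N)"
  shows
    "(CHAR('a) = 0 \<longrightarrow>
        (N_component N 1 = H \<and> (\<forall>m\<ge>2. recurrence_at (N_component N) m)) \<and>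
        (\<forall>M :: nat \<Rightarrow> ('a, 'n) ncps ^ 'n.
          M 1 = H \<and> (\<forall>m\<ge>2. recurrence_at M m) \<longrightarrow> (\<forall>m\<ge>1. M m = N_component N m))) \<and>
     (\<forall>p. CHAR('a) = p \<and> p > 0 \<longrightarrow>
        N_component N 1 = H \<and>
        (\<forall>m\<ge>2. \<not> [m = 1] (mod p) \<longrightarrow> recurrence_at (N_component N) m) \<and>
        (\<forall>q\<ge>1. \<forall>m. m = q * p + 1 \<longrightarrow>
          N_component N m =
            - ncv_map fls_residue (\<Sum>l = 1..m - 1.
                nc_const (fls_X_intpow (int l - int m - 1)) *s
                  ncv_map fps_to_fls
                    (ncv_subst (ncv_map fps_const (N_component N l)) (F_map H)))))"
proof -
  note inv = inverse_maps_F_mapD[OF assms(2)]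
  have N1: "N_component N 1 = H"
    by (rule N_component_1) (rule inv(2))
  \<comment> \<open>Divisibility by \<open>CHAR('a)\<close> treats both cases at once: for
    characteristic 0 it would force \<open>m = 1\<close>, otherwise it means that \<open>m\<close>
    is congruent to 1.\<close>
  have rec: "recurrence_at (N_component N) m"
    if "m \<ge> 2" and "\<not> CHAR('a) dvd m - 1" for m
  proof (rule recurrence_at_iff[THEN iffD2])
    show "of_nat (m - 1) \<noteq> (0 :: 'a)"
      using that(2) by (simp only: of_nat_eq_0_iff_char_dvd not_False_eq_True)
  qed (rule smult_N_component[OF evolution_equation[OF inv(1,2)] that(1)])
  have rec0: "\<forall>m\<ge>2. recurrence_at (N_component N) m" if "CHAR('a) = 0"
    using that by (auto intro!: rec)
  have recp: "recurrence_at (N_component N) m" if "m \<ge> 2" and "\<not> [m = 1] (mod CHAR('a))" for m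
    using that by (intro rec) (simp_all add: cong_altdef_nat)
  have res: "N_component N m = - ncv_map fls_residue (\<Sum>l = 1..m - 1.
      nc_const (fls_X_intpow (int l - int m - 1)) *s
        ncv_map fps_to_fls (ncv_subst (ncv_map fps_const (N_component N l)) (F_map H)))"
    if "q \<ge> 1" and "p > 0" and "m = q * p + 1" for m p q :: nat
  proof (rule N_component_residue[OF inv(3)])
    have "0 < q * p"
      using that by simp
    then show "m \<ge> 2"
      using that(3) by linarith
  qed
  have uniq: "M m = N_component N m"
    if "CHAR('a) = 0" and "M 1 = H \<and> (\<forall>m\<ge>2. recurrence_at M m)" and "m \<ge> 1"
    for M :: "nat \<Rightarrow> ('a, 'n) ncps ^ 'n" and m
    by (rule recurrence_unique[OF _ _ rec0]) (use that N1 in simp_all)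
  show ?thesis
  \<comment> \<open>Goals 1 and 4 are the initial value \<open>N_[1] = H\<close>; the closing
    \<open>rule N1\<close> settles them.\<close>
  proof (intro conjI impI allI, goal_cases)
    case (2 m)
    then show ?case
      using rec0 by simp
  next
    case (3 M m)
    then show ?case
      by (rule uniq)
  next
    case (5 p m)
    then show ?case
      by (intro recp) simp_all
  next
    case (6 p q m)
    then show ?case
      by (intro res[of q p]) simp_all
  qed (rule N1)+
qed

end
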